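(* Let $D$ be the derivation on Laurent polynomials in $a,b,x,y,z$ determined by $$D(a)=az,\quad D(b)=xy,\quad D(x)=xy,\quad D(y)=xy,\quad D(z)=xy$$ (extended by linearity and the Leibniz rule), and for a Laurent polynomial $w$ let $\mathrm{Gen}(w,t)=\sum_{n\ge0}D^n(w)\frac{t^n}{n!}$. Then, as formal power series in $t$, $$\mathrm{Gen}(ab,t)=\frac{a(y-x)e^{zt}}{ye^{xt}-xe^{yt}}\left(\frac{x-y}{1-yx^{-1}e^{(x-y)t}}-x+b\right).$$
   Context: $D^0(w)=w$. Here $D$ is the formal derivative associated with the grammar $\{a\to az,\ b\to xy,\ x\to xy,\ y\to xy,\ z\to xy\}$. *)

theory Defs
  imports
    "HOL-Library.Poly_Mapping"
    "HOL-Computational_Algebra.Formal_Power_Series"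
    "HOL-Computational_Algebra.Polynomial_Factorial"
begin

section \<open>Laurent polynomials in five variables\<close>

datatype gvar = Va | Vb | Vx | Vy | Vz

lemma UNIV_gvar: "(UNIV :: gvar set) = {Va, Vb, Vx, Vy, Vz}"
  using gvar.exhaust by blast

instance gvar :: finite
  by standard (simp add: UNIV_gvar)

text \<open>The order on variables has no mathematical meaning: the library's proof that a monoid
  ring is an integral domain, and hence has a fraction field, needs ordered exponents.\<close>

primrec gvar_index :: "gvar \<Rightarrow> nat" where
  "gvar_index Va = 0"
| "gvar_index Vb = 1"
| "gvar_index Vx = 2"
| "gvar_index Vy = 3"
| "gvar_index Vz = 4"

instantiation gvar :: linorder
begin

definition less_eq_gvar :: "gvar \<Rightarrow> gvar \<Rightarrow> bool"
  where "u \<le> v \<longleftrightarrow> gvar_index u \<le> gvar_index v"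

definition less_gvar :: "gvar \<Rightarrow> gvar \<Rightarrow> bool"
  where "u < v \<longleftrightarrow> gvar_index u < gvar_index v"

instance
proof
  fix u v :: gvar
  assume "u \<le> v" "v \<le> u"
  then show "u = v"
    by (cases u; cases v) (simp_all add: less_eq_gvar_def)
qed (auto simp: less_eq_gvar_def less_gvar_def)

end

text \<open>A monomial is its vector of integer exponents, so a Laurent polynomial is an element of
  the group algebra of the free abelian group on the five variables.\<close>

type_synonym 'k laurent = "(gvar \<Rightarrow>\<^sub>0 int) \<Rightarrow>\<^sub>0 'k"

definition lconst :: "'k::comm_ring_1 \<Rightarrow> 'k laurent"
  where "lconst c = Poly_Mapping.single 0 c"

definition lvar :: "gvar \<Rightarrow> 'k::comm_ring_1 laurent"
  where "lvar v = Poly_Mapping.single (Poly_Mapping.single v 1) 1"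

section \<open>The derivation of the grammar\<close>

definition is_derivation :: "('k::comm_ring_1 laurent \<Rightarrow> 'k laurent) \<Rightarrow> bool"
  where "is_derivation D \<longleftrightarrow>
    (\<forall>u w. D (u + w) = D u + D w) \<and>
    (\<forall>c u. D (lconst c * u) = lconst c * D u) \<and>
    (\<forall>u w. D (u * w) = D u * w + u * D w)"

definition is_grammar_derivation :: "('k::comm_ring_1 laurent \<Rightarrow> 'k laurent) \<Rightarrow> bool"
  where "is_grammar_derivation D \<longleftrightarrow> is_derivation D \<and>
    D (lvar Va) = lvar Va * lvar Vz \<and>
    D (lvar Vb) = lvar Vx * lvar Vy \<and>
    D (lvar Vx) = lvar Vx * lvar Vy \<and>
    D (lvar Vy) = lvar Vx * lvar Vy \<and>
    D (lvar Vz) = lvar Vx * lvar Vy"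

text \<open>Existence and uniqueness are shown in \<open>ex1_grammar_derivation\<close> below.\<close>

definition grammar_D :: "'k::comm_ring_1 laurent \<Rightarrow> 'k laurent"
  where "grammar_D = (THE D. is_grammar_derivation D)"

lemma laurent_induct [case_names single add]:
  fixes f :: "'k::comm_ring_1 laurent"
  assumes single: "\<And>m c. P (Poly_Mapping.single m c)"
    and add: "\<And>f g. P f \<Longrightarrow> P g \<Longrightarrow> P (f + g)"
  shows "P f"
proof (induction f rule: Poly_Mapping.update_induct)
  case const
  show ?case using single[of 0 0] by simp
next
  case (update f a b)
  have "Poly_Mapping.update a b f = f + Poly_Mapping.single a b"
    using update(1)
    by (intro poly_mapping_eqI)
      (auto simp: lookup_update lookup_add lookup_single in_keys_iff when_def)
  with add[OF update(3) single] show ?case by simp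
qed

subsection \<open>Existence\<close>

text \<open>The logarithmic partial derivative: multiply each monomial by its exponent at \<open>v\<close>.\<close>

definition log_deriv :: "gvar \<Rightarrow> 'k::comm_ring_1 laurent \<Rightarrow> 'k laurent"
  where "log_deriv v f = Poly_Mapping.mapp (\<lambda>m c. of_int (Poly_Mapping.lookup m v) * c) f"

lemma lookup_log_deriv:
  "Poly_Mapping.lookup (log_deriv v f) m = of_int (Poly_Mapping.lookup m v) * Poly_Mapping.lookup f m"
  unfolding log_deriv_def by (simp add: Poly_Mapping.lookup_mapp when_def in_keys_iff)

lemma log_deriv_add: "log_deriv v (f + g) = log_deriv v f + log_deriv v g"
  by (intro poly_mapping_eqI) (simp add: lookup_log_deriv lookup_add algebra_simps)

lemma log_deriv_single:
  "log_deriv v (Poly_Mapping.single m c) = Poly_Mapping.single m (of_int (Poly_Mapping.lookup m v) * c)"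
  by (intro poly_mapping_eqI) (auto simp: lookup_log_deriv lookup_single when_def)

lemma log_deriv_mult: "log_deriv v (f * g) = log_deriv v f * g + f * log_deriv v g"
proof (induction f rule: laurent_induct)
  case (single m c)
  show ?case
  proof (induction g rule: laurent_induct)
    case (single n d)
    show ?case
      by (simp add: log_deriv_single mult_single lookup_add algebra_simps flip: single_add)
  qed (simp add: log_deriv_add algebra_simps)
qed (simp add: log_deriv_add algebra_simps)

lemma log_deriv_lconst: "log_deriv v (lconst c * f) = lconst c * log_deriv v f"
  by (simp add: log_deriv_mult) (simp add: lconst_def log_deriv_single)

lemma log_deriv_lvar: "log_deriv v (lvar w) = (if v = w then lvar w else 0)"
  by (auto simp: lvar_def log_deriv_single lookup_single when_def)

definition lvar_inv :: "gvar \<Rightarrow> 'k::comm_ring_1 laurent"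
  where "lvar_inv v = Poly_Mapping.single (Poly_Mapping.single v (-1)) 1"

lemma lvar_inv: "lvar v * lvar_inv v = 1"
  by (simp add: lvar_def lvar_inv_def mult_single flip: single_add)

primrec grammar_rhs :: "gvar \<Rightarrow> 'k::comm_ring_1 laurent" where
  "grammar_rhs Va = lvar Va * lvar Vz"
| "grammar_rhs Vb = lvar Vx * lvar Vy"
| "grammar_rhs Vx = lvar Vx * lvar Vy"
| "grammar_rhs Vy = lvar Vx * lvar Vy"
| "grammar_rhs Vz = lvar Vx * lvar Vy"

lemma grammar_derivation_exists:
  "is_grammar_derivation (\<lambda>f. \<Sum>v\<in>UNIV. grammar_rhs v * lvar_inv v * log_deriv v f)"
    (is "is_grammar_derivation ?D")
proof -
  have "?D (lvar w) = grammar_rhs w" for w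
  proof -
    have "?D (lvar w) = (\<Sum>v\<in>UNIV. if v = w then grammar_rhs w * lvar_inv w * lvar w else 0)"
      by (intro sum.cong) (auto simp: log_deriv_lvar)
    also have "\<dots> = grammar_rhs w * (lvar w * lvar_inv w)"
      by (simp add: algebra_simps)
    finally show ?thesis by (simp add: lvar_inv)
  qed
  moreover have "is_derivation ?D"
    unfolding is_derivation_def
  proof (intro conjI allI)
    show "?D (u + w) = ?D u + ?D w" for u w
      by (simp add: log_deriv_add distrib_left sum.distrib)
    show "?D (lconst c * u) = lconst c * ?D u" for c u
      unfolding log_deriv_lconst sum_distrib_left by (simp only: mult_ac)
    show "?D (u * w) = ?D u * w + u * ?D w" for u w
      by (simp add: log_deriv_mult distrib_left sum.distrib sum_distrib_left sum_distrib_right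
          mult_ac)
  qed
  ultimately show ?thesis unfolding is_grammar_derivation_def by simp
qed

subsection \<open>Uniqueness\<close>

lemma derivation_unique:
  fixes D E :: "'k::comm_ring_1 laurent \<Rightarrow> 'k laurent"
  assumes D: "is_derivation D" and E: "is_derivation E"
    and vars: "\<And>v. D (lvar v) = E (lvar v)"
  shows "D = E"
proof
  fix f :: "'k laurent"
  let ?s = "\<lambda>m. Poly_Mapping.single m (1::'k)"
  have lD: "D (u * w) = D u * w + u * D w" and lE: "E (u * w) = E u * w + u * E w"
    and cD: "D (lconst c * u) = lconst c * D u" and cE: "E (lconst c * u) = lconst c * E u"
    and aD: "D (u + w) = D u + D w" and aE: "E (u + w) = E u + E w" for u w c
    using D E unfolding is_derivation_def by blast+
  have one: "D 1 = 0" "E 1 = 0"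
    using lD[of 1 1] lE[of 1 1] by simp_all
  have mono: "D (?s m) = E (?s m)" for m
  proof (rule Poly_Mapping.frag_induction[of m UNIV "\<lambda>m. D (?s m) = E (?s m)"])
    show "D (?s 0) = E (?s 0)" by (simp add: one)
  next
    fix v show "D (?s (frag_of v)) = E (?s (frag_of v))"
      using vars[of v] by (simp add: lvar_def)
  next
    fix a b assume a: "D (?s a) = E (?s a)" and b: "D (?s b) = E (?s b)"
    have eq: "?s (a - b) * ?s b = ?s a" and unit: "?s b * ?s (- b) = 1"
      by (simp_all add: mult_single)
    have "D (?s (a - b)) * ?s b = E (?s (a - b)) * ?s b"
      using lD[of "?s (a - b)" "?s b"] lE[of "?s (a - b)" "?s b"] a b unfolding eq by simp
    then have "D (?s (a - b)) * (?s b * ?s (- b)) = E (?s (a - b)) * (?s b * ?s (- b))"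
      by (simp only: mult.assoc[symmetric])
    then show "D (?s (a - b)) = E (?s (a - b))" by (simp add: unit)
  qed simp
  show "D f = E f"
  proof (induction f rule: laurent_induct)
    case (single m c)
    have "Poly_Mapping.single m c = lconst c * ?s m" by (simp add: lconst_def mult_single)
    then show ?case by (simp only: cD cE mono)
  next
    case (add f g)
    then show ?case by (simp add: aD aE)
  qed
qed

lemma ex1_grammar_derivation:
  "\<exists>!D :: 'k::comm_ring_1 laurent \<Rightarrow> 'k laurent. is_grammar_derivation D"
proof (rule ex_ex1I)
  fix D E :: "'k laurent \<Rightarrow> 'k laurent"
  assume DE: "is_grammar_derivation D" "is_grammar_derivation E"
  then have "D (lvar v) = E (lvar v)" for v
    by (cases v) (simp_all add: is_grammar_derivation_def)
  with DE show "D = E"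
    by (intro derivation_unique) (simp_all add: is_grammar_derivation_def)
qed (use grammar_derivation_exists in blast)

lemma is_grammar_derivation_grammar_D: "is_grammar_derivation grammar_D"
  unfolding grammar_D_def by (rule theI'[OF ex1_grammar_derivation])

section \<open>Generating functions\<close>

definition Gen :: "'k::field_char_0 laurent \<Rightarrow> 'k laurent fps"
  where "Gen w = Abs_fps (\<lambda>n. lconst (1 / fact n) * (grammar_D ^^ n) w)"

text \<open>Laurent polynomials do not contain the inverse of \<open>y - x\<close>, the constant term of a
  denominator of the closed form; the two sides are compared as power series
  over the field of rational functions. There both denominators have nonzero constant terms
  \<open>y - x\<close> and \<open>(x - y) / x\<close>, so that division of power series
  is multiplication by the inverse.\<close>

definition fps_to_fract :: "'a::idom fps \<Rightarrow> 'a fract fps"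
  where "fps_to_fract F = Abs_fps (\<lambda>n. to_fract (fps_nth F n))"

instance fract :: ("{idom, ring_char_0}") field_char_0
proof
  show "inj (of_nat :: nat \<Rightarrow> 'a fract)"
    by (rule injI) (simp add: of_nat_fract eq_fract)
qed

end

(* Since D is a derivation, Gen is a ring homomorphism with Gen(w)' = Gen(D w), so the series
   A, B, X, Y, Z of the variables solve A' = A Z and B' = X' = Y' = Z' = X Y. Hence
   B - X, X - Y and X - Z are constant, which leaves the logistic equation X' = X (X - (x - y))
   for X and a linear equation for A. Both closed forms are verified, with denominators cleared,
   by showing that the difference of the two sides solves a homogeneous linear equation with
   initial value 0. *)

theory Submission
  imports Defs
begin

lemma grammar_D_add: "grammar_D (u + w) = grammar_D u + grammar_D w"
  and grammar_D_mult: "grammar_D (u * w) = grammar_D u * w + u * grammar_D w"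
  using is_grammar_derivation_grammar_D
  unfolding is_grammar_derivation_def is_derivation_def by blast+

lemma grammar_D_lvar: "grammar_D (lvar v) = (grammar_rhs v :: 'k::comm_ring_1 laurent)"
  using is_grammar_derivation_grammar_D[where ?'a = 'k]
  by (cases v) (simp_all add: is_grammar_derivation_def)

lemma grammar_D_pow_add:
  "(grammar_D ^^ n) (u + w) = (grammar_D ^^ n) u + (grammar_D ^^ n) w"
  by (induction n) (simp_all add: grammar_D_add)

lemma lconst_mult: "lconst (c * d) = lconst c * lconst d"
  by (simp add: lconst_def mult_single)

lemma lconst_1 [simp]: "lconst 1 = 1"
  by (simp add: lconst_def)

lemma lconst_of_nat: "lconst (of_nat n) = of_nat n"
  by (induction n) (simp_all add: lconst_def single_add)

lemma lvar_neq_0: "lvar v \<noteq> 0"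
  by (metis lvar_inv mult_zero_left zero_neq_one)

text \<open>The logarithmic derivative at \<open>v\<close> fixes \<open>lvar v\<close> and kills
  every other variable. This separation is what makes x - y nonzero in the fraction field.\<close>

lemma lvar_eq_iff: "lvar v = lvar w \<longleftrightarrow> v = w"
proof
  assume "lvar v = (lvar w :: 'a laurent)"
  from arg_cong[OF this, of "log_deriv v"] show "v = w"
    using lvar_neq_0[of v] by (auto simp: log_deriv_lvar split: if_splits)
qed simp

lemma Gen_nth_0 [simp]: "fps_nth (Gen w) 0 = w"
  by (simp add: Gen_def)

lemma Gen_add: "Gen (u + w) = Gen u + Gen w"
  by (rule fps_ext) (simp add: Gen_def grammar_D_pow_add distrib_left)

lemma fps_deriv_Gen: "fps_deriv (Gen w) = Gen (grammar_D w)"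
proof (rule fps_ext)
  fix n
  have "of_nat (n + 1) * (1 / fact (n + 1)) = (1 / fact n :: 'a)"
    by (simp add: field_simps del: of_nat_Suc)
  then have "of_nat (n + 1) * lconst (1 / fact (n + 1)) = (lconst (1 / fact n) :: 'a laurent)"
    by (metis lconst_mult lconst_of_nat)
  then show "fps_nth (fps_deriv (Gen w)) n = fps_nth (Gen (grammar_D w :: 'a laurent)) n"
    by (simp add: Gen_def funpow_swap1 mult.assoc[symmetric] del: of_nat_Suc)
qed

text \<open>Comparing derivatives replaces the binomial Leibniz formula for powers of D: both sides
  differentiate to sums of the same shape, with D applied to one factor. Hence the coefficient
  induction needs \<open>u\<close> and \<open>w\<close> arbitrary.\<close>

lemma Gen_mult: "Gen (u * w) = Gen u * Gen w"
proof (rule fps_ext)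
  fix n
  show "fps_nth (Gen (u * w)) n = fps_nth (Gen u * Gen w) n"
  proof (induction n arbitrary: u w)
    case (Suc n)
    have "fps_nth (fps_deriv (Gen (u * w))) n = fps_nth (fps_deriv (Gen u * Gen w)) n"
      by (simp add: fps_deriv_Gen grammar_D_mult Gen_add Suc.IH)
    then have "of_nat (Suc n) * fps_nth (Gen (u * w)) (Suc n)
             = of_nat (Suc n) * fps_nth (Gen u * Gen w) (Suc n)"
      by (simp only: fps_deriv_nth Suc_eq_plus1)
    then show ?case by (simp only: mult_cancel_left of_nat_eq_0_iff) simp
  qed simp
qed

lemma to_fract_of_nat: "to_fract (of_nat n) = of_nat n"
  by (induction n) simp_all

lemma fps_to_fract_mult: "fps_to_fract (F * G) = fps_to_fract F * fps_to_fract G"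
  by (rule fps_ext) (simp add: fps_to_fract_def fps_mult_nth to_fract_sum)

lemma fps_to_fract_deriv: "fps_deriv (fps_to_fract F) = fps_to_fract (fps_deriv F)"
  by (rule fps_ext) (simp add: fps_to_fract_def to_fract_of_nat del: of_nat_Suc)

text \<open>Coefficient m of \<open>Q * P\<close> involves only the coefficients of \<open>P\<close>
  up to m, so the equation is a recursion that propagates the initial zero; characteristic 0 allows
  division by m + 1.\<close>

lemma fps_linear_ode_zero:
  fixes P Q :: "'a::field_char_0 fps"
  assumes deriv: "fps_deriv P = Q * P" and init: "fps_nth P 0 = 0"
  shows "P = 0"
proof (rule fps_ext)
  fix n
  show "fps_nth P n = fps_nth 0 n"
  proof (induction n rule: less_induct)
    case (less n)
    show ?case
    proof (cases n)
      case (Suc m)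
      have "of_nat (Suc m) * fps_nth P (Suc m) = fps_nth (Q * P) m"
        by (simp flip: deriv)
      also have "\<dots> = 0"
        using less Suc by (simp add: fps_mult_nth)
      finally show ?thesis using Suc by (simp del: of_nat_Suc)
    qed (simp add: init)
  qed
qed

lemma fps_eq_const_diff:
  fixes F G :: "'a::field_char_0 fps"
  assumes "fps_deriv F = fps_deriv G"
  shows "F = G + fps_const (fps_nth F 0 - fps_nth G 0)"
  using assms by (simp add: fps_deriv_eq_iff add.commute)

text \<open>The closed form arises because, with d = x - y, the reciprocal u = 1/X turns the
  logistic equation into the linear one u' = d u - 1.\<close>

lemma logistic_system_solution:
  fixes X Y :: "'a::field_char_0 fps"
  assumes X': "fps_deriv X = X * Y" and Y': "fps_deriv Y = X * Y"
    and X0: "fps_nth X 0 = x" and Y0: "fps_nth Y 0 = y" and "x \<noteq> 0"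
  shows "X * (1 - fps_const (y * inverse x) * fps_exp (x - y)) = fps_const (x - y)"
proof -
  define K where "K = fps_const (y * inverse x) * fps_exp (x - y)"
  let ?P = "X * (1 - K) - fps_const (x - y)"
  have Y: "Y = X - fps_const (x - y)"
    using fps_eq_const_diff[of Y X] X' Y' X0 Y0 by (simp flip: fps_const_sub)
  have K': "fps_deriv K = fps_const (x - y) * K"
    by (simp add: K_def algebra_simps)
  \<comment> \<open>Here X' = X (X - d) and K' = d K with d = x - y, so the derivative is X ((X - d)
    (1 - K) - d K), and the terms in d K cancel.\<close>
  have "fps_deriv ?P = X * ?P"
    by (simp add: X' K' Y algebra_simps)
  moreover have "fps_nth ?P 0 = 0"
    using \<open>x \<noteq> 0\<close> by (simp add: K_def X0 field_simps)
  ultimately have "?P = 0" by (rule fps_linear_ode_zero)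
  then show ?thesis by (simp add: K_def)
qed

lemma grammar_system_solution:
  fixes A B X Y Z :: "'a::field_char_0 fps"
  assumes A': "fps_deriv A = A * Z" and B': "fps_deriv B = X * Y" and X': "fps_deriv X = X * Y"
    and Y': "fps_deriv Y = X * Y" and Z': "fps_deriv Z = X * Y"
    and init: "fps_nth A 0 = a" "fps_nth B 0 = b" "fps_nth X 0 = x" "fps_nth Y 0 = y"
      "fps_nth Z 0 = z"
    and "x \<noteq> 0" "x \<noteq> y"
  shows "A * B = fps_const (a * (y - x)) * fps_exp z /
                (fps_const y * fps_exp x - fps_const x * fps_exp y) *
              (fps_const (x - y) / (1 - fps_const (y * inverse x) * fps_exp (x - y))
                - fps_const x + fps_const b)"
proof -
  define W where "W = fps_const y * fps_exp x - fps_const x * fps_exp y"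
  define V where "V = 1 - fps_const (y * inverse x) * fps_exp (x - y)"
  have XV: "X * V = fps_const (x - y)"
    unfolding V_def using X' Y' init \<open>x \<noteq> 0\<close> by (intro logistic_system_solution)
  have "fps_nth V 0 \<noteq> 0" using \<open>x \<noteq> 0\<close> \<open>x \<noteq> y\<close> by (simp add: V_def field_simps)
  then have V0: "V \<noteq> 0" by auto
  then have X: "X = fps_const (x - y) / V"
    by (metis XV nonzero_mult_div_cancel_right)
  have "fps_nth W 0 \<noteq> 0" using \<open>x \<noteq> y\<close> by (simp add: W_def)
  then have W0: "W \<noteq> 0" by auto
  have B: "B = X - fps_const x + fps_const b"
    using fps_eq_const_diff[of B X] B' X' init by (simp flip: fps_const_sub)
  have Z: "Z = X - fps_const x + fps_const z"
    using fps_eq_const_diff[of Z X] Z' X' init by (simp flip: fps_const_sub)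
  \<comment> \<open>The next two identities extract the factor x e^{yt} from \<open>W\<close>. The
    two denominators thus agree up to an invertible factor, and \<open>X * W\<close> becomes free of
    denominators.\<close>
  have e: "fps_exp x = fps_exp y * fps_exp (x - y)"
    by (simp flip: fps_exp_add_mult)
  have c: "fps_const y = fps_const x * fps_const (y * inverse x)"
    using \<open>x \<noteq> 0\<close> by (simp add: field_simps)
  have "W = - (fps_const x * fps_exp y * V)"
    unfolding W_def V_def e c
    by (simp only: right_diff_distrib mult_1_left mult_1_right minus_diff_eq mult_ac)
  then have "X * W = - (fps_const x * fps_exp y * (X * V))"
    by (simp only: mult_minus_right mult_ac)
  then have XW: "X * W = - (fps_const x * fps_exp y * fps_const (x - y))"
    by (simp only: XV)
  \<comment> \<open>\<open>W\<close> is an integrating factor for A' = A Z: the product rule now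
    leaves (A W)' = z A W, so \<open>A * W\<close> is a constant multiple of e^{zt}.\<close>
  have W': "fps_deriv W = - ((Z - fps_const z) * W)"
  proof -
    have "fps_deriv W = fps_const x * fps_const y * (fps_exp x - fps_exp y)"
      by (simp add: W_def algebra_simps flip: fps_const_mult)
    also have "\<dots> = - ((X - fps_const x) * W)"
      unfolding left_diff_distrib XW
      by (simp add: W_def algebra_simps flip: fps_const_sub fps_const_mult)
    finally show ?thesis by (simp add: Z)
  qed
  let ?P = "A * W - fps_const (a * (y - x)) * fps_exp z"
  have "fps_deriv ?P = fps_const z * ?P"
    by (simp add: A' W' algebra_simps)
  moreover have "fps_nth ?P 0 = 0"
    by (simp add: W_def init)
  ultimately have "?P = 0" by (rule fps_linear_ode_zero)
  then have "A = fps_const (a * (y - x)) * fps_exp z / W"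
    by (metis W0 nonzero_mult_div_cancel_right eq_iff_diff_eq_0)
  then show ?thesis
    unfolding B X by (simp only: W_def V_def)
qed

theorem theorem3p7:
  shows "let a = to_fract (lvar Va :: 'k::field_char_0 laurent);
             b = to_fract (lvar Vb);
             x = to_fract (lvar Vx);
             y = to_fract (lvar Vy);
             z = to_fract (lvar Vz)
         in fps_to_fract (Gen (lvar Va * lvar Vb)) =
              fps_const (a * (y - x)) * fps_exp z /
                (fps_const y * fps_exp x - fps_const x * fps_exp y) *
              (fps_const (x - y) / (1 - fps_const (y * inverse x) * fps_exp (x - y))
                - fps_const x + fps_const b)"
proof -
  let ?G = "\<lambda>v. fps_to_fract (Gen (lvar v :: 'k laurent))"
  have deriv: "fps_deriv (?G v) = fps_to_fract (Gen (grammar_rhs v))" for v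
    by (simp add: fps_to_fract_deriv fps_deriv_Gen grammar_D_lvar)
  have init: "fps_nth (?G v) 0 = to_fract (lvar v)" for v
    by (simp add: fps_to_fract_def)
  have "fps_to_fract (Gen (lvar Va * lvar Vb :: 'k laurent)) = ?G Va * ?G Vb"
    by (simp add: Gen_mult fps_to_fract_mult)
  \<comment> \<open>The conditions that x is nonzero and differs from y descend to Laurent
    polynomials by injectivity of \<open>to_fract\<close>.\<close>
  then show ?thesis
    unfolding Let_def
    by (simp only:)
      (rule grammar_system_solution[where X = "?G Vx" and Y = "?G Vy" and Z = "?G Vz"],
        simp_all add: deriv init Gen_mult fps_to_fract_mult lvar_neq_0 lvar_eq_iff)
qed

end
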